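(* Consider a causal model over a set $S$ of observed random variables on a causal structure $\mathcal G$, let $X,Y,Z\subseteq S$ be pairwise disjoint with $X,Y$ non-empty, and suppose the affects relation $X\vDash Y\mid\mathrm{do}(Z)$ holds. If this affects relation satisfies Clus$_i$ for some $i\in\{1,2,3\}$, then the causal model is fine-tuned.
   Context: **Causal model.** A causal structure is a directed graph $\mathcal G$ (cycles allowed) whose nodes are observed or unobserved; the finitely many observed nodes are random variables. For sets of nodes, $AB:=A\cup B$. A path between two nodes (ignoring edge directions) is blocked by a set $C$ if it contains a chain $A\to V\to B$ or fork $A\leftarrow V\to B$ with $V\in C$, or a collider $A\to V\leftarrow B$ with neither $V$ nor any descendant of $V$ in $C$. For disjoint $A,B,C$, $(A\perp^dB\mid C)_{\mathcal G}$ means every path from an element of $A$ to an element of $B$ is blocked by $C$. A distribution $P$ over the observed nodes has the d-separation property relative to $\mathcal G$ if $(A\perp^dB|C)_{\mathcal G}$ implies $P(AB|C)=P(A|C)P(B|C)$ for all disjoint sets $A,B,C$ of observed nodes. For a set $X$ of observed nodes, $\mathcal G_{\mathrm{do}(X)}$ is $\mathcal G$ with all edges into nodes of $X$ removed ($\mathcal G_{\mathrm{do}(\emptyset)}=\mathcal G$). A causal model consists of $\mathcal G$, and for every set $X$ of observed nodes a distribution $P_{\mathcal G_{\mathrm{do}(X)}}$ of the observed nodes with the d-separation property relative to $\mathcal G_{\mathrm{do}(X)}$, such that if $X$ consists of nodes exogenous in $\mathcal G$ and is disjoint from $Y$, then $P_{\mathcal G_{\mathrm{do}(Y)}}(R|XY)=P_{\mathcal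 G_{\mathrm{do}(XY)}}(R|XY)$ for $R$ the remaining observed nodes. Conditional distributions given values of intervened nodes are taken as specified for all such values. Standing fact of the framework (third rule of do-calculus): for disjoint sets of observed nodes, $P_{\mathcal G_{\mathrm{do}(XZ)}}(Y|XZ)=P_{\mathcal G_{\mathrm{do}(X)}}(Y|X)$ whenever $(Y\perp^dZ\mid X)_{\mathcal G_{\mathrm{do}(XZ)}}$. $(A\perp\!\!\!\perp B\mid C)_{\mathcal G'}$ means $P_{\mathcal G'}(AB|C)=P_{\mathcal G'}(A|C)P_{\mathcal G'}(B|C)$. **Fine-tuning.** The causal model is faithful if for every set $I$ of observed nodes and all mutually disjoint sets $A,B,C$ of observed nodes (possibly overlapping $I$), $(A\perp\!\!\!\perp B\mid C)_{\mathcal G_{\mathrm{do}(I)}}$ implies $(A\perp^dB\mid C)_{\mathcal G_{\mathrm{do}(I)}}$. Otherwise it is fine-tuned. **Affects relations.** For pairwise disjoint $X,Y,Z$ with $X,Y$ non-empty, $X\vDash Y\mid\mathrm{do}(Z)$ holds iff there are values $x,z$ with $P_{\mathcal G_{\mathrm{do}(XZ)}}(Y|X=x,Z=z)\ne P_{\mathcal G_{\mathrm{do}(Z)}}(Y|Z=z)$. **Clustering** of $X\vDash Y\mid\mathrm{do}(Z)$: - Clus$_1$: $|X|\ge2$ and no (non-empty) $s_X\subsetneq X$ satisfies $s_X\vDash Y\mid\mathrm{do}(Z)$. - Clus$_2$: $|Y|\ge2$ and no (non-empty) $s_Y\subsetneq Y$ satisfies $X\vDash s_Y\mid\mathrm{do}(Z)$.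 - Clus$_3$: $|Z|\ge1$ and no $s_Z\subsetneq Z$ (possibly empty) satisfies $X\vDash Y\mid\mathrm{do}(s_Z)$. *)

theory Defs
  imports "HOL-Probability.Probability" "Graph_Theory.Pair_Digraph"
begin

section \<open>d-separation in directed graphs, cycles allowed\<close>

text \<open>
  A path ignoring edge directions is a list of distinct nodes together with the list of the
  edges it uses. Recording the edges matters in cyclic graphs: if both \<open>(u, v)\<close> and \<open>(v, u)\<close> are
  edges, a path through \<open>u\<close> and \<open>v\<close> may use either of them, and these are two different paths.
\<close>

definition upath :: "'v pair_pre_digraph \<Rightarrow> 'v list \<Rightarrow> ('v \<times> 'v) list \<Rightarrow> bool" where
  "upath G vs es \<longleftrightarrow>
     length vs = Suc (length es) \<and> distinct vs \<and> set vs \<subseteq> pverts G \<and> set es \<subseteq> parcs G \<and>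
     (\<forall>i<length es. es ! i = (vs ! i, vs ! Suc i) \<or> es ! i = (vs ! Suc i, vs ! i))"

definition chain_at :: "'v list \<Rightarrow> ('v \<times> 'v) list \<Rightarrow> nat \<Rightarrow> bool" where
  "chain_at vs es i \<longleftrightarrow>
     es ! (i - 1) = (vs ! (i - 1), vs ! i) \<and> es ! i = (vs ! i, vs ! Suc i) \<or>
     es ! (i - 1) = (vs ! i, vs ! (i - 1)) \<and> es ! i = (vs ! Suc i, vs ! i)"

definition fork_at :: "'v list \<Rightarrow> ('v \<times> 'v) list \<Rightarrow> nat \<Rightarrow> bool" where
  "fork_at vs es i \<longleftrightarrow>
     es ! (i - 1) = (vs ! i, vs ! (i - 1)) \<and> es ! i = (vs ! i, vs ! Suc i)"

definition collider_at :: "'v list \<Rightarrow> ('v \<times> 'v) list \<Rightarrow> nat \<Rightarrow> bool" where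
  "collider_at vs es i \<longleftrightarrow>
     es ! (i - 1) = (vs ! (i - 1), vs ! i) \<and> es ! i = (vs ! Suc i, vs ! i)"

text \<open>The indices \<open>0 < i < length es\<close> are those of the interior nodes of the path.\<close>

definition blocked :: "'v pair_pre_digraph \<Rightarrow> 'v set \<Rightarrow> 'v list \<Rightarrow> ('v \<times> 'v) list \<Rightarrow> bool" where
  "blocked G C vs es \<longleftrightarrow> (\<exists>i. 0 < i \<and> i < length es \<and>
     ((chain_at vs es i \<or> fork_at vs es i) \<and> vs ! i \<in> C \<or>
      collider_at vs es i \<and> vs ! i \<notin> C \<and> (\<forall>w\<in>C. \<not> reachable1 (with_proj G) (vs ! i) w)))"

definition d_sep ::
  "'v pair_pre_digraph \<Rightarrow> 'v set \<Rightarrow> 'v set \<Rightarrow> 'v set \<Rightarrow> bool" where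
  "d_sep G A B C \<longleftrightarrow>
     (\<forall>vs es. upath G vs es \<and> hd vs \<in> A \<and> last vs \<in> B \<longrightarrow> blocked G C vs es)"

definition do_graph :: "'v pair_pre_digraph \<Rightarrow> 'v set \<Rightarrow> 'v pair_pre_digraph" where
  "do_graph G X = G\<lparr>parcs := {e \<in> parcs G. snd e \<notin> X}\<rparr>"

definition exogenous :: "'v pair_pre_digraph \<Rightarrow> 'v \<Rightarrow> bool" where
  "exogenous G v \<longleftrightarrow> (\<forall>u. (u, v) \<notin> parcs G)"

definition disjoint3 :: "'v set \<Rightarrow> 'v set \<Rightarrow> 'v set \<Rightarrow> bool" where
  "disjoint3 A B C \<longleftrightarrow> A \<inter> B = {} \<and> A \<inter> C = {} \<and> B \<inter> C = {}"


section \<open>Conditional distributions and conditional independence\<close>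

text \<open>
  A joint distribution of the variables in \<open>S\<close> is a probability measure on \<open>PiM S V\<close>, where the
  measurable space \<open>V v\<close> holds the values of variable \<open>v\<close>; only the sigma-algebra of \<open>V v\<close> is
  relevant. Values of a set \<open>A\<close> of variables are elements of \<open>space (PiM A V)\<close>. No discreteness
  is assumed, so conditional distributions are Markov kernels.
\<close>

text \<open>\<open>K\<close> is a version of the conditional distribution \<open>P(A|C)\<close>.\<close>

definition cond_version ::
  "('v \<Rightarrow> 'a measure) \<Rightarrow> ('v \<Rightarrow> 'a) measure \<Rightarrow> 'v set \<Rightarrow> 'v set \<Rightarrow>
   (('v \<Rightarrow> 'a) \<Rightarrow> ('v \<Rightarrow> 'a) measure) \<Rightarrow> bool" where
  "cond_version V P A C K \<longleftrightarrow>
     K \<in> PiM C V \<rightarrow>\<^sub>M prob_algebra (PiM A V) \<and>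
     (\<forall>E\<in>sets (PiM A V). \<forall>F\<in>sets (PiM C V).
        emeasure P {w \<in> space P. restrict w A \<in> E \<and> restrict w C \<in> F} =
        (\<integral>\<^sup>+w. emeasure (K (restrict w C)) E * indicator F (restrict w C) \<partial>P))"

definition generated_by ::
  "('v \<Rightarrow> 'a measure) \<Rightarrow> ('v \<Rightarrow> 'a) measure \<Rightarrow> 'v set \<Rightarrow> ('v \<Rightarrow> 'a) measure" where
  "generated_by V P C = vimage_algebra (space P) (\<lambda>w. restrict w C) (PiM C V)"

text \<open>\<open>P(AB|C) = P(A|C) P(B|C)\<close>\<close>

definition cond_indep ::
  "('v \<Rightarrow> 'a measure) \<Rightarrow> ('v \<Rightarrow> 'a) measure \<Rightarrow> 'v set \<Rightarrow> 'v set \<Rightarrow> 'v set \<Rightarrow> bool" where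
  "cond_indep V P A B C \<longleftrightarrow>
     (\<forall>E\<in>sets (PiM A V). \<forall>F\<in>sets (PiM B V). AE w in P.
        real_cond_exp P (generated_by V P C)
          (\<lambda>u. indicator E (restrict u A) * indicator F (restrict u B)) w =
        real_cond_exp P (generated_by V P C) (\<lambda>u. indicator E (restrict u A)) w *
        real_cond_exp P (generated_by V P C) (\<lambda>u. indicator F (restrict u B)) w)"


section \<open>Causal models\<close>

text \<open>
  \<open>dist M X\<close> is the distribution of all observed nodes under \<open>do(X)\<close>. For every value \<open>x\<close> of the
  intervened nodes \<open>X\<close>, \<open>cond M X x\<close> is the conditional distribution, under \<open>do(X)\<close>, of the
  remaining observed nodes given \<open>X = x\<close>. It belongs to the data of the model because
  \<open>dist M X\<close> does not determine it at values \<open>x\<close> of probability zero.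
\<close>

record ('v, 'a) causal_data =
  graph :: "'v pair_pre_digraph"
  observed :: "'v set"
  val :: "'v \<Rightarrow> 'a measure"
  dist :: "'v set \<Rightarrow> ('v \<Rightarrow> 'a) measure"
  cond :: "'v set \<Rightarrow> ('v \<Rightarrow> 'a) \<Rightarrow> ('v \<Rightarrow> 'a) measure"

definition d_sep_property ::
  "('v, 'a) causal_data \<Rightarrow> ('v \<Rightarrow> 'a) measure \<Rightarrow> 'v pair_pre_digraph \<Rightarrow> bool" where
  "d_sep_property M P G \<longleftrightarrow>
     (\<forall>A B C. A \<subseteq> observed M \<and> B \<subseteq> observed M \<and> C \<subseteq> observed M \<and> disjoint3 A B C \<and>
        d_sep G A B C \<longrightarrow> cond_indep (val M) P A B C)"

text \<open>
  The last condition is \<open>P\<^bsub>do(Y)\<^esub>(R|XY) = P\<^bsub>do(XY)\<^esub>(R|XY)\<close> for exogenous \<open>X\<close>. As \<open>X\<close> is not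
  intervened on in the left-hand side, that side is defined only up to null sets of \<open>P\<^bsub>do(Y)\<^esub>\<close>.
\<close>

definition causal_model :: "('v, 'a) causal_data \<Rightarrow> bool" where
  "causal_model M \<longleftrightarrow>
     pair_wf_digraph (graph M) \<and> observed M \<subseteq> pverts (graph M) \<and> finite (observed M) \<and>
     (\<forall>X\<subseteq>observed M.
        dist M X \<in> space (prob_algebra (PiM (observed M) (val M))) \<and>
        cond_version (val M) (dist M X) (observed M - X) X (cond M X) \<and>
        d_sep_property M (dist M X) (do_graph (graph M) X)) \<and>
     (\<forall>X Y. X \<subseteq> observed M \<and> Y \<subseteq> observed M \<and> X \<inter> Y = {} \<and> (\<forall>v\<in>X. exogenous (graph M) v) \<longrightarrow>
        cond_version (val M) (dist M Y) (observed M - (X \<union> Y)) (X \<union> Y) (cond M (X \<union> Y)))"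

text \<open>\<open>P\<^bsub>do(X)\<^esub>(A|X = x)\<close>, for \<open>A\<close> disjoint from \<open>X\<close>\<close>

definition do_dist ::
  "('v, 'a) causal_data \<Rightarrow> 'v set \<Rightarrow> 'v set \<Rightarrow> ('v \<Rightarrow> 'a) \<Rightarrow> ('v \<Rightarrow> 'a) measure" where
  "do_dist M X A x = distr (cond M X x) (PiM A (val M)) (\<lambda>w. restrict w A)"

text \<open>The third rule of do-calculus; it does not follow from \<^const>\<open>causal_model\<close>.\<close>

definition do_rule3 :: "('v, 'a) causal_data \<Rightarrow> bool" where
  "do_rule3 M \<longleftrightarrow>
     (\<forall>X Y Z. X \<subseteq> observed M \<and> Y \<subseteq> observed M \<and> Z \<subseteq> observed M \<and> disjoint3 X Y Z \<and>
        d_sep (do_graph (graph M) (X \<union> Z)) Y Z X \<longrightarrow>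
        (\<forall>w\<in>space (PiM (X \<union> Z) (val M)).
           do_dist M (X \<union> Z) Y w = do_dist M X Y (restrict w X)))"

definition faithful :: "('v, 'a) causal_data \<Rightarrow> bool" where
  "faithful M \<longleftrightarrow>
     (\<forall>I A B C. I \<subseteq> observed M \<and> A \<subseteq> observed M \<and> B \<subseteq> observed M \<and> C \<subseteq> observed M \<and>
        disjoint3 A B C \<and> cond_indep (val M) (dist M I) A B C \<longrightarrow>
        d_sep (do_graph (graph M) I) A B C)"

definition fine_tuned :: "('v, 'a) causal_data \<Rightarrow> bool" where
  "fine_tuned M \<longleftrightarrow> \<not> faithful M"


section \<open>Affects relations and clustering\<close>

text \<open>
  \<open>affects M X Y Z\<close> is meant for pairwise disjoint sets of observed nodes with \<open>X\<close> and \<open>Y\<close>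
  non-empty. The assignment \<open>w\<close> comprises the values \<open>x\<close> and \<open>z\<close>.
\<close>

definition affects :: "('v, 'a) causal_data \<Rightarrow> 'v set \<Rightarrow> 'v set \<Rightarrow> 'v set \<Rightarrow> bool" where
  "affects M X Y Z \<longleftrightarrow>
     (\<exists>w\<in>space (PiM (X \<union> Z) (val M)).
        do_dist M (X \<union> Z) Y w \<noteq> do_dist M Z Y (restrict w Z))"

definition clus1 :: "('v, 'a) causal_data \<Rightarrow> 'v set \<Rightarrow> 'v set \<Rightarrow> 'v set \<Rightarrow> bool" where
  "clus1 M X Y Z \<longleftrightarrow> card X \<ge> 2 \<and> \<not> (\<exists>s. s \<noteq> {} \<and> s \<subset> X \<and> affects M s Y Z)"

definition clus2 :: "('v, 'a) causal_data \<Rightarrow> 'v set \<Rightarrow> 'v set \<Rightarrow> 'v set \<Rightarrow> bool" where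
  "clus2 M X Y Z \<longleftrightarrow> card Y \<ge> 2 \<and> \<not> (\<exists>s. s \<noteq> {} \<and> s \<subset> Y \<and> affects M X s Z)"

definition clus3 :: "('v, 'a) causal_data \<Rightarrow> 'v set \<Rightarrow> 'v set \<Rightarrow> 'v set \<Rightarrow> bool" where
  "clus3 M X Y Z \<longleftrightarrow> card Z \<ge> 1 \<and> \<not> (\<exists>s. s \<subset> Z \<and> affects M X Y s)"

end

theory Submission
  imports Defs
begin

text \<open>
  In \<open>do_graph G (X \<union> Z)\<close> no edge enters \<open>X \<union> Z\<close>, so a path from \<open>Y\<close> to \<open>X\<close> not blocked by \<open>Z\<close> is
  a directed path from some \<open>x \<in> X\<close> to some \<open>y \<in> Y\<close> avoiding \<open>Z\<close>. Such a path stays unblocked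
  when fewer nodes are intervened on, so d-separation also fails after shrinking \<open>X\<close> to \<open>{x}\<close>,
  \<open>Y\<close> to \<open>{y}\<close> or \<open>Z\<close> to \<open>{}\<close>. By the third rule of do-calculus, an affects relation provides such
  a path, whereas a missing affects relation makes \<open>P(Y|XZ)\<close> independent of \<open>X\<close> and thus yields a
  conditional independence. A clustered affects relation gives both for the shrunken sets.
\<close>

section \<open>Unblocked paths between interventions and outcomes\<close>

lemma not_reachable1_if_no_in_arcs:
  assumes "\<And>u. (u, w) \<notin> parcs G"
  shows "\<not> reachable1 (with_proj G) v w"
proof
  assume "reachable1 (with_proj G) v w"
  then obtain u where "(u, w) \<in> arcs_ends (with_proj G)"
    by (meson tranclE)
  then show False
    using assms by auto
qed

text \<open>The last edge must leave \<open>last vs\<close>, as nothing enters that node. If edge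
  \<open>i\<close> enters \<open>vs ! i\<close>, then \<open>vs ! i\<close> is not in
  \<open>C\<close>. Were edge \<open>i - 1\<close> to enter it too, it would be a collider with no
  descendant in \<open>C\<close>, since no edge enters a node of \<open>C\<close>, and the path
  would be blocked. So every edge points towards the start of the path.\<close>

lemma unblocked_path_directed:
  assumes path: "upath G vs es" and unblocked: "\<not> blocked G C vs es"
    and last: "\<And>u. (u, last vs) \<notin> parcs G" and C: "\<And>u c. c \<in> C \<Longrightarrow> (u, c) \<notin> parcs G"
    and "i < length es"
  shows "es ! i = (vs ! Suc i, vs ! i)"
proof -
  let ?n = "length es"
  have len: "length vs = Suc ?n" and arcs: "set es \<subseteq> parcs G"
    and step: "\<And>i. i < ?n \<Longrightarrow> es ! i = (vs ! i, vs ! Suc i) \<or> es ! i = (vs ! Suc i, vs ! i)"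
    using path by (auto simp: upath_def)
  have last_eq: "last vs = vs ! ?n"
    using len by (metis Zero_not_Suc diff_Suc_1 last_conv_nth list.size(3))
  \<comment> \<open>The induction runs backwards: \<open>k\<close> counts the edges between the
    current one and the end, so \<open>k = 0\<close> is the last edge.\<close>
  have "es ! (?n - Suc k) = (vs ! Suc (?n - Suc k), vs ! (?n - Suc k))" if "k < ?n" for k
    using that
  proof (induction k)
    case 0
    then have "Suc (?n - Suc 0) = ?n" "?n - Suc 0 < ?n" by auto
    then show ?case
      using step[of "?n - Suc 0"] last last_eq arcs by (metis nth_mem subsetD)
  next
    case (Suc k)
    define i where "i = ?n - Suc k"
    have i: "0 < i" "i < ?n" "?n - Suc (Suc k) = i - 1" "Suc (i - 1) = i"
      using Suc.prems by (auto simp: i_def)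
    have out: "es ! i = (vs ! Suc i, vs ! i)"
      using Suc by (simp add: i_def)
    then have notC: "vs ! i \<notin> C"
      using C arcs i(2) by (metis nth_mem subsetD)
    have "es ! (i - 1) \<noteq> (vs ! (i - 1), vs ! i)"
    proof
      assume "es ! (i - 1) = (vs ! (i - 1), vs ! i)"
      then have "collider_at vs es i"
        using out by (simp add: collider_at_def)
      moreover have "\<forall>w\<in>C. \<not> reachable1 (with_proj G) (vs ! i) w"
        using C not_reachable1_if_no_in_arcs by metis
      ultimately have "blocked G C vs es"
        using i notC unfolding blocked_def by blast
      then show False
        using unblocked by contradiction
    qed
    then have "es ! (i - 1) = (vs ! Suc (i - 1), vs ! (i - 1))"
      using step[of "i - 1"] i by auto
    then show ?case
      using i by simp
  qed
  from this[of "?n - Suc i"] show ?thesis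
    using \<open>i < length es\<close> by simp
qed

text \<open>Hypothesis \<open>C\<close> excludes blocking at chains and forks, and a path directed
  towards its start has no colliders.\<close>

lemma directed_path_unblocked:
  assumes path: "upath G vs es"
    and dir: "\<And>i. i < length es \<Longrightarrow> es ! i = (vs ! Suc i, vs ! i)"
    and C: "\<And>i. 0 < i \<Longrightarrow> i < length es \<Longrightarrow> vs ! i \<notin> C"
  shows "\<not> blocked G C vs es"
proof
  assume "blocked G C vs es"
  then obtain i where i: "0 < i" "i < length es" "collider_at vs es i"
    using C unfolding blocked_def by blast
  \<comment> \<open>At a collider, edge \<open>i - 1\<close> would equal its own reversal, which
    distinctness of the nodes forbids.\<close>
  have "vs ! (i - 1) \<noteq> vs ! i"
    using path i by (simp add: upath_def nth_eq_iff_index_eq)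
  moreover have "es ! (i - 1) = (vs ! i, vs ! (i - 1))"
    using dir[of "i - 1"] i by (simp add: less_imp_diff_less)
  ultimately show False
    using i by (simp add: collider_at_def)
qed

text \<open>One unblocked path serves all smaller sets: its end nodes are \<open>x\<close> and
  \<open>y\<close>, its edges survive when fewer nodes are intervened on, and being directed and off
  \<open>Z\<close> it stays unblocked.\<close>

lemma not_d_sep_do_graph_shrink:
  assumes "\<not> d_sep (do_graph G (X \<union> Z)) Y X Z"
  obtains x y where "x \<in> X" "y \<in> Y"
    "\<And>X' Y' Z'. \<lbrakk>x \<in> X'; y \<in> Y'; X' \<subseteq> X; Z' \<subseteq> Z\<rbrakk> \<Longrightarrow> \<not> d_sep (do_graph G (X' \<union> Z')) Y' X' Z'"
proof -
  obtain vs es where path: "upath (do_graph G (X \<union> Z)) vs es"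
    and ends: "hd vs \<in> Y" "last vs \<in> X"
    and unblocked: "\<not> blocked (do_graph G (X \<union> Z)) Z vs es"
    using assms unfolding d_sep_def by blast
  have dir: "es ! i = (vs ! Suc i, vs ! i)" if "i < length es" for i
    by (rule unblocked_path_directed[OF path unblocked _ _ that])
      (use ends in \<open>auto simp: do_graph_def\<close>)
  have arcs: "set es \<subseteq> parcs (do_graph G (X \<union> Z))"
    using path by (simp add: upath_def)
  \<comment> \<open>Every node but the last is entered by an edge of the path, and the intervention
    has removed all edges into \<open>Z\<close>.\<close>
  have interior: "vs ! i \<notin> Z" if "i < length es" for i
  proof -
    have "(vs ! Suc i, vs ! i) \<in> parcs (do_graph G (X \<union> Z))"
      using dir[OF that] arcs that by (metis nth_mem subsetD)
    then show ?thesis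
      by (simp add: do_graph_def)
  qed
  show ?thesis
  proof (rule that[OF ends(2,1)])
    fix X' Y' Z'
    assume sub: "last vs \<in> X'" "hd vs \<in> Y'" "X' \<subseteq> X" "Z' \<subseteq> Z"
    have path': "upath (do_graph G (X' \<union> Z')) vs es"
      using path sub(3,4) by (auto simp: upath_def do_graph_def)
    moreover have "\<not> blocked (do_graph G (X' \<union> Z')) Z' vs es"
      using directed_path_unblocked[OF path' dir] interior sub(4) by blast
    ultimately show "\<not> d_sep (do_graph G (X' \<union> Z')) Y' X' Z'"
      using sub(1,2) unfolding d_sep_def by blast
  qed
qed


section \<open>Conditional distributions\<close>

text \<open>An event about \<open>A\<close> is also an event about \<open>D\<close>, namely its
  preimage under restriction, and the pushforward kernel gives it the same mass.\<close>

lemma cond_version_marginal: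
  assumes P: "P \<in> space (prob_algebra (PiM S V))" and "D \<subseteq> S" "C \<subseteq> S" "A \<subseteq> D"
    and K: "cond_version V P D C K"
  shows "cond_version V P A C (\<lambda>u. distr (K u) (PiM A V) (\<lambda>w. restrict w A))"
proof -
  have K_meas: "K \<in> PiM C V \<rightarrow>\<^sub>M prob_algebra (PiM D V)"
    and K_int: "\<And>E F. E \<in> sets (PiM D V) \<Longrightarrow> F \<in> sets (PiM C V) \<Longrightarrow>
        emeasure P {w \<in> space P. restrict w D \<in> E \<and> restrict w C \<in> F} =
        (\<integral>\<^sup>+w. emeasure (K (restrict w C)) E * indicator F (restrict w C) \<partial>P)"
    using K by (auto simp: cond_version_def)
  have restr: "(\<lambda>w. restrict w A) \<in> PiM D V \<rightarrow>\<^sub>M PiM A V"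
    using \<open>A \<subseteq> D\<close> by (rule measurable_restrict_subset)
  have space_P: "space P = space (PiM S V)"
    using P by (auto simp: space_prob_algebra dest: sets_eq_imp_space_eq)
  have restrict_space: "restrict w B \<in> space (PiM B V)" if "w \<in> space P" "B \<subseteq> S" for w B
    using that by (auto simp: space_P space_PiM PiE_def Pi_def)
  have distr_meas: "(\<lambda>u. distr (K u) (PiM A V) (\<lambda>w. restrict w A)) \<in> PiM C V \<rightarrow>\<^sub>M prob_algebra (PiM A V)"
    using K_meas measurable_distr_prob_space[OF restr] by (rule measurable_compose)
  moreover have "emeasure P {w \<in> space P. restrict w A \<in> E \<and> restrict w C \<in> F} =
      (\<integral>\<^sup>+w. emeasure (distr (K (restrict w C)) (PiM A V) (\<lambda>w. restrict w A)) E
        * indicator F (restrict w C) \<partial>P)"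
    if E: "E \<in> sets (PiM A V)" and F: "F \<in> sets (PiM C V)" for E F
  proof -
    define E' where "E' = (\<lambda>w. restrict w A) -` E \<inter> space (PiM D V)"
    have E': "E' \<in> sets (PiM D V)"
      unfolding E'_def using restr E by (rule measurable_sets)
    have "restrict w D \<in> E' \<longleftrightarrow> restrict w A \<in> E" if "w \<in> space P" for w
      using restrict_space[OF that \<open>D \<subseteq> S\<close>] \<open>A \<subseteq> D\<close>
      by (simp add: E'_def Int_absorb1)
    then have "{w \<in> space P. restrict w A \<in> E \<and> restrict w C \<in> F} =
        {w \<in> space P. restrict w D \<in> E' \<and> restrict w C \<in> F}"
      by auto
    also have "emeasure P \<dots> = (\<integral>\<^sup>+w. emeasure (K (restrict w C)) E' * indicator F (restrict w C) \<partial>P)"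
      by (rule K_int[OF E' F])
    also have "\<dots> = (\<integral>\<^sup>+w. emeasure (distr (K (restrict w C)) (PiM A V) (\<lambda>w. restrict w A)) E
        * indicator F (restrict w C) \<partial>P)"
    proof (rule nn_integral_cong)
      fix w assume "w \<in> space P"
      \<comment> \<open>Applying \<open>emeasure_distr\<close> requires knowing the sigma-algebra of
        this measure; the measurability of \<open>K\<close> gives it at points of
        \<open>space (PiM C V)\<close>.\<close>
      then have "K (restrict w C) \<in> space (prob_algebra (PiM D V))"
        using K_meas restrict_space[OF _ \<open>C \<subseteq> S\<close>] by (auto dest: measurable_space)
      then have sets: "sets (K (restrict w C)) = sets (PiM D V)"
        by (simp add: space_prob_algebra)
      have "(\<lambda>w. restrict w A) \<in> K (restrict w C) \<rightarrow>\<^sub>M PiM A V"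
        using restr measurable_cong_sets[OF sets refl] by blast
      then have "emeasure (distr (K (restrict w C)) (PiM A V) (\<lambda>w. restrict w A)) E =
          emeasure (K (restrict w C)) E'"
        using E sets_eq_imp_space_eq[OF sets] by (simp add: emeasure_distr E'_def)
      then show "emeasure (K (restrict w C)) E' * indicator F (restrict w C) =
          emeasure (distr (K (restrict w C)) (PiM A V) (\<lambda>w. restrict w A)) E * indicator F (restrict w C)"
        by simp
    qed
    finally show ?thesis .
  qed
  ultimately show ?thesis
    unfolding cond_version_def by blast
qed

text \<open>A kernel enters \<open>cond_version\<close> only through its values on
  \<open>space (PiM C V)\<close>. This matters because absence of an affects relation gives equality
  of kernels only there.\<close>

lemma cond_version_cong:
  assumes P: "P \<in> space (prob_algebra (PiM S V))" and "C \<subseteq> S"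
    and eq: "\<And>u. u \<in> space (PiM C V) \<Longrightarrow> K u = L u"
    and K: "cond_version V P A C K"
  shows "cond_version V P A C L"
proof -
  have "space P = space (PiM S V)"
    using P by (auto simp: space_prob_algebra dest: sets_eq_imp_space_eq)
  then have "restrict w C \<in> space (PiM C V)" if "w \<in> space P" for w
    using that \<open>C \<subseteq> S\<close> by (auto simp: space_PiM PiE_def Pi_def)
  then have "(\<integral>\<^sup>+w. emeasure (K (restrict w C)) E * indicator F (restrict w C) \<partial>P) =
      (\<integral>\<^sup>+w. emeasure (L (restrict w C)) E * indicator F (restrict w C) \<partial>P)" for E F
    by (intro nn_integral_cong) (simp add: eq)
  moreover have "K \<in> PiM C V \<rightarrow>\<^sub>M prob_algebra (PiM A V) \<longleftrightarrow> L \<in> PiM C V \<rightarrow>\<^sub>M prob_algebra (PiM A V)"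
    by (rule measurable_cong) (rule eq)
  ultimately show ?thesis
    using K by (simp add: cond_version_def)
qed

section \<open>Conditional expectations given the values of a set of variables\<close>

lemma subalgebra_vimage_algebra:
  assumes "f \<in> M \<rightarrow>\<^sub>M N" "space M = \<Omega>"
  shows "subalgebra M (vimage_algebra \<Omega> f N)"
proof -
  have "f \<in> \<Omega> \<rightarrow> space N"
    using assms by (auto dest: measurable_space)
  then show ?thesis
    using assms by (auto simp: subalgebra_def sets_vimage_algebra2 intro: measurable_sets)
qed

lemma subalgebra_generated_by:
  assumes "sets P = sets (PiM S V)" "C \<subseteq> S"
  shows "subalgebra P (generated_by V P C)"
proof -
  have "(\<lambda>w. restrict w C) \<in> P \<rightarrow>\<^sub>M PiM C V"
    using measurable_restrict_subset[OF \<open>C \<subseteq> S\<close>] measurable_cong_sets[OF assms(1) refl] by blast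
  then show ?thesis
    unfolding generated_by_def by (rule subalgebra_vimage_algebra) (rule refl)
qed

text \<open>Restriction to \<open>B\<close> factors through restriction to \<open>C\<close>, which
  generates the sigma-algebra.\<close>

lemma measurable_generated_by:
  assumes "sets P = sets (PiM S V)" "C \<subseteq> S" "B \<subseteq> C" "f \<in> PiM B V \<rightarrow>\<^sub>M N"
  shows "(\<lambda>w. f (restrict w B)) \<in> generated_by V P C \<rightarrow>\<^sub>M N"
proof -
  have "space P = space (PiM S V)"
    using assms(1) by (rule sets_eq_imp_space_eq)
  then have "(\<lambda>w. restrict w C) \<in> space P \<rightarrow> space (PiM C V)"
    using \<open>C \<subseteq> S\<close> by (auto simp: space_PiM PiE_def Pi_def)
  then have "(\<lambda>w. restrict w C) \<in> generated_by V P C \<rightarrow>\<^sub>M PiM C V"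
    unfolding generated_by_def by (rule measurable_vimage_algebra1)
  then have "(\<lambda>w. f (restrict (restrict w C) B)) \<in> generated_by V P C \<rightarrow>\<^sub>M N"
    by (intro measurable_compose[OF measurable_compose[OF _ measurable_restrict_subset[OF \<open>B \<subseteq> C\<close>]] assms(4)])
  then show ?thesis
    using \<open>B \<subseteq> C\<close> by (simp add: Int_absorb1)
qed

text \<open>Write \<open>a\<close>, \<open>b\<close> for the indicators of the two events and
  \<open>h\<close> for the mass that \<open>K\<close> gives to \<open>E\<close>. Then
  \<open>h\<close> is the conditional expectation of \<open>a\<close> given
  \<open>B \<union> C\<close> and depends on \<open>C\<close> only. By the tower property it is also
  that of \<open>a\<close> given \<open>C\<close>, and pulling out first \<open>b\<close>, then
  \<open>h\<close>, factorizes the conditional expectation of the product.\<close>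

lemma cond_indep_if_kernel_ignores:
  assumes P: "P \<in> space (prob_algebra (PiM S V))" and "A \<subseteq> S" "B \<subseteq> S" "C \<subseteq> S"
    and K: "K \<in> PiM C V \<rightarrow>\<^sub>M prob_algebra (PiM A V)"
    and version: "cond_version V P A (B \<union> C) (\<lambda>u. K (restrict u C))"
  shows "cond_indep V P A B C"
  unfolding cond_indep_def
proof (intro ballI)
  fix E F assume E: "E \<in> sets (PiM A V)" and F: "F \<in> sets (PiM B V)"
  have sets_P: "sets P = sets (PiM S V)" and "prob_space P"
    using P by (auto simp: space_prob_algebra)
  interpret P: prob_space P by fact
  have space_P: "space P = space (PiM S V)"
    using sets_P by (rule sets_eq_imp_space_eq)
  define G where "G = generated_by V P (B \<union> C)"
  define H where "H = generated_by V P C"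
  have sub: "subalgebra P G" "subalgebra P H"
    unfolding G_def H_def using assms by (auto intro!: subalgebra_generated_by[OF sets_P])
  \<comment> \<open>The tower property needs the coarser information \<open>H\<close>, on
    \<open>C\<close>, to be contained in \<open>G\<close>, on \<open>B \<union> C\<close>.\<close>
  have HG: "subalgebra G H"
  proof -
    have "(\<lambda>w. restrict w C) \<in> G \<rightarrow>\<^sub>M PiM C V"
      unfolding G_def by (rule measurable_generated_by[OF sets_P, where f = id, simplified])
        (use assms in auto)
    moreover have "space G = space P"
      by (simp add: G_def generated_by_def)
    ultimately show ?thesis
      unfolding H_def generated_by_def by (rule subalgebra_vimage_algebra)
  qed
  interpret G: finite_measure_subalgebra P G
    by (unfold_locales) (rule sub(1))
  interpret H: finite_measure_subalgebra P H
    by (unfold_locales) (rule sub(2))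

  define a where "a = (\<lambda>u. indicator E (restrict u A) :: real)"
  define b where "b = (\<lambda>u. indicator F (restrict u B) :: real)"
  define h where "h = (\<lambda>u. measure (K (restrict u C)) E)"
  have restr: "(\<lambda>w. restrict w D) \<in> P \<rightarrow>\<^sub>M PiM D V" if "D \<subseteq> S" for D
    using measurable_restrict_subset[OF that] measurable_cong_sets[OF sets_P refl] by blast
  have a_P: "a \<in> borel_measurable P"
    unfolding a_def using restr[OF \<open>A \<subseteq> S\<close>] E by measurable
  have b_G: "b \<in> borel_measurable G"
    unfolding b_def G_def
    by (rule measurable_generated_by[OF sets_P]) (use assms F in auto)
  have K_E: "(\<lambda>u. measure (K u) E) \<in> borel_measurable (PiM C V)"
    by (rule measurable_compose[OF measurable_prob_algebraD[OF K] measurable_measure_subprob_algebra[OF E]])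
  have h_G: "h \<in> borel_measurable G" and h_H: "h \<in> borel_measurable H"
    unfolding h_def G_def H_def
    by (rule measurable_generated_by[OF sets_P _ _ K_E]; use assms in auto)+
  note b_P = measurable_from_subalg[OF sub(1) b_G]
    and h_P = measurable_from_subalg[OF sub(1) h_G]
  have K_prob: "prob_space (K (restrict w C))" if "w \<in> space P" for w
    using measurable_space[OF K, of "restrict w C"] measurable_space[OF restr[OF \<open>C \<subseteq> S\<close>] that]
    by (simp add: space_prob_algebra)
  have bounds: "\<bar>a w\<bar> \<le> 1" "\<bar>b w\<bar> \<le> 1" for w
    by (auto simp: a_def b_def indicator_def)
  have h_bound: "\<bar>h w\<bar> \<le> 1" if "w \<in> space P" for w
    using prob_space.prob_le_1[OF K_prob[OF that]] by (simp add: h_def)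
  have int_a: "integrable P a" and int_b: "integrable P b"
    using bounds a_P b_P by (auto intro!: P.integrable_const_bound[where B = 1])
  have int_h: "integrable P h"
    using h_bound h_P by (auto intro!: P.integrable_const_bound[where B = 1] AE_I2)
  have int_ba: "integrable P (\<lambda>w. b w * a w)"
    using bounds a_P b_P by (auto intro!: P.integrable_const_bound[where B = 1] mult_le_one AE_I2 simp: abs_mult)
  have int_hb: "integrable P (\<lambda>w. h w * b w)"
    using bounds h_bound h_P b_P
    by (auto intro!: P.integrable_const_bound[where B = 1] AE_I2 mult_le_one simp: abs_mult)

  have given_G: "AE w in P. real_cond_exp P G a w = h w"
  proof (rule G.real_cond_exp_charact[OF _ int_a int_h h_G])
    fix D assume "D \<in> sets G"
    \<comment> \<open>A set of \<open>G\<close> is the preimage of some \<open>F'\<close>, so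
      equality of the integrals over it is the defining equation of \<open>version\<close> for
      \<open>E\<close> and \<open>F'\<close>.\<close>
    then obtain F' where F': "F' \<in> sets (PiM (B \<union> C) V)"
      and D: "D = (\<lambda>w. restrict w (B \<union> C)) -` F' \<inter> space P"
      unfolding G_def generated_by_def
      using measurable_space[OF restr, of "B \<union> C"] assms by (auto simp: sets_vimage_algebra2)
    have D_P: "D \<in> sets P"
      using \<open>D \<in> sets G\<close> sub(1) by (auto simp: subalgebra_def)
    have "(\<integral>\<^sup>+w. ennreal (indicator D w * a w) \<partial>P) =
        (\<integral>\<^sup>+w. indicator {w \<in> space P. restrict w A \<in> E \<and> restrict w (B \<union> C) \<in> F'} w \<partial>P)"
      by (rule nn_integral_cong) (auto simp: D a_def indicator_def)
    also have "\<dots> = emeasure P {w \<in> space P. restrict w A \<in> E \<and> restrict w (B \<union> C) \<in> F'}"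
    proof (rule nn_integral_indicator)
      have "(\<lambda>w. restrict w A) -` E \<inter> space P \<in> sets P"
        using restr[OF \<open>A \<subseteq> S\<close>] E by (rule measurable_sets)
      then have "((\<lambda>w. restrict w A) -` E \<inter> space P) \<inter> D \<in> sets P"
        using D_P by (rule sets.Int)
      also have "((\<lambda>w. restrict w A) -` E \<inter> space P) \<inter> D =
          {w \<in> space P. restrict w A \<in> E \<and> restrict w (B \<union> C) \<in> F'}"
        by (auto simp: D)
      finally show "{w \<in> space P. restrict w A \<in> E \<and> restrict w (B \<union> C) \<in> F'} \<in> sets P" .
    qed
    also have "\<dots> = (\<integral>\<^sup>+w. emeasure (K (restrict (restrict w (B \<union> C)) C)) E
        * indicator F' (restrict w (B \<union> C)) \<partial>P)"
      using version E F' by (simp add: cond_version_def)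
    also have "\<dots> = (\<integral>\<^sup>+w. ennreal (indicator D w * h w) \<partial>P)"
    proof (rule nn_integral_cong)
      fix w assume w: "w \<in> space P"
      interpret K: prob_space "K (restrict w C)" by (rule K_prob[OF w])
      have "restrict (restrict w (B \<union> C)) C = restrict w C"
        by (simp add: Int_absorb1)
      then show "emeasure (K (restrict (restrict w (B \<union> C)) C)) E * indicator F' (restrict w (B \<union> C)) =
          ennreal (indicator D w * h w)"
        using w by (simp add: D h_def K.emeasure_eq_measure indicator_def)
    qed
    finally have nn_eq: "(\<integral>\<^sup>+w. ennreal (indicator D w * a w) \<partial>P) = (\<integral>\<^sup>+w. ennreal (indicator D w * h w) \<partial>P)" .
    \<comment> \<open>Both integrands are nonnegative, so the equality passes from the extended
      nonnegative integral to the real one.\<close>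
    have "(\<integral>w. indicator D w * a w \<partial>P) = (\<integral>w. indicator D w * h w \<partial>P)"
      using nn_eq a_P h_P D_P
      by (subst (1 2) integral_eq_nn_integral) (auto simp: a_def h_def)
    then show "(LINT w:D|P. a w) = (LINT w:D|P. h w)"
      by (simp add: set_lebesgue_integral_def)
  qed

  have h_a: "AE w in P. real_cond_exp P H a w = h w"
  proof -
    have "AE w in P. real_cond_exp P H (real_cond_exp P G a) w = real_cond_exp P H a w"
      by (rule H.real_cond_exp_nested_subalg[OF sub(1) HG int_a])
    moreover have "AE w in P. real_cond_exp P H (real_cond_exp P G a) w = real_cond_exp P H h w"
      by (rule H.real_cond_exp_cong[OF given_G]) (use h_P in auto)
    moreover have "AE w in P. real_cond_exp P H h w = h w"
      by (rule H.real_cond_exp_F_meas[OF int_h h_H])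
    ultimately show ?thesis
      by eventually_elim simp
  qed
  have h_ba: "AE w in P. real_cond_exp P H (\<lambda>w. b w * a w) w = h w * real_cond_exp P H b w"
  proof -
    have "AE w in P. real_cond_exp P G (\<lambda>w. b w * a w) w = b w * real_cond_exp P G a w"
      by (rule G.real_cond_exp_mult[OF b_G a_P int_ba])
    then have "AE w in P. real_cond_exp P G (\<lambda>w. b w * a w) w = h w * b w"
      using given_G by eventually_elim simp
    then have "AE w in P. real_cond_exp P H (real_cond_exp P G (\<lambda>w. b w * a w)) w =
        real_cond_exp P H (\<lambda>w. h w * b w) w"
      by (rule H.real_cond_exp_cong) (use h_P b_P in auto)
    moreover have "AE w in P. real_cond_exp P H (real_cond_exp P G (\<lambda>w. b w * a w)) w =
        real_cond_exp P H (\<lambda>w. b w * a w) w"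
      by (rule H.real_cond_exp_nested_subalg[OF sub(1) HG int_ba])
    moreover have "AE w in P. real_cond_exp P H (\<lambda>w. h w * b w) w = h w * real_cond_exp P H b w"
      by (rule H.real_cond_exp_mult[OF h_H b_P int_hb])
    ultimately show ?thesis
      by eventually_elim simp
  qed
  have "AE w in P. real_cond_exp P H (\<lambda>w. a w * b w) w = real_cond_exp P H a w * real_cond_exp P H b w"
    using h_a h_ba by eventually_elim (simp add: mult.commute)
  then show "AE w in P.
        real_cond_exp P (generated_by V P C)
          (\<lambda>u. indicator E (restrict u A) * indicator F (restrict u B)) w =
        real_cond_exp P (generated_by V P C) (\<lambda>u. indicator E (restrict u A)) w *
        real_cond_exp P (generated_by V P C) (\<lambda>u. indicator F (restrict u B)) w"
    by (simp add: a_def b_def H_def)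
qed


section \<open>Affects relations and d-separation\<close>

text \<open>Without an affects relation, the kernel for \<open>do(Z)\<close>, precomposed with
  restriction to \<open>Z\<close>, is a version of the conditional distribution of \<open>Y\<close>
  given \<open>X \<union> Z\<close> under \<open>do(X \<union> Z)\<close>. It ignores the values of
  \<open>X\<close>.\<close>

lemma cond_indep_if_not_affects:
  assumes M: "causal_model M"
    and XYZ: "X \<subseteq> observed M" "Y \<subseteq> observed M" "Z \<subseteq> observed M" "disjoint3 X Y Z"
    and "\<not> affects M X Y Z"
  shows "cond_indep (val M) (dist M (X \<union> Z)) Y X Z"
proof -
  let ?S = "observed M" and ?V = "val M"
  have XZ: "X \<union> Z \<subseteq> ?S" and Y: "Y \<subseteq> ?S - (X \<union> Z)" "Y \<subseteq> ?S - Z"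
    using XYZ by (auto simp: disjoint3_def)
  have P: "dist M W \<in> space (prob_algebra (PiM ?S ?V))"
    and version: "cond_version ?V (dist M W) (?S - W) W (cond M W)" if "W \<subseteq> ?S" for W
    using M that by (auto simp: causal_model_def)
  have marginal: "cond_version ?V (dist M W) Y W (do_dist M W Y)" if "W \<subseteq> ?S" "Y \<subseteq> ?S - W" for W
    using cond_version_marginal[OF P[OF that(1)] _ that(1,2) version[OF that(1)]]
    unfolding do_dist_def[abs_def] by blast
  have "do_dist M (X \<union> Z) Y w = do_dist M Z Y (restrict w Z)" if "w \<in> space (PiM (X \<union> Z) ?V)" for w
    using \<open>\<not> affects M X Y Z\<close> that by (auto simp: affects_def)
  then have "cond_version ?V (dist M (X \<union> Z)) Y (X \<union> Z) (\<lambda>w. do_dist M Z Y (restrict w Z))"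
    by (rule cond_version_cong[OF P[OF XZ] XZ _ marginal[OF XZ Y(1)]])
  \<comment> \<open>The marginal under \<open>do(Z)\<close> supplies measurability in the values of
    \<open>Z\<close> alone.\<close>
  moreover have "do_dist M Z Y \<in> PiM Z ?V \<rightarrow>\<^sub>M prob_algebra (PiM Y ?V)"
    using marginal[OF XYZ(3) Y(2)] by (simp add: cond_version_def)
  ultimately show ?thesis
    by (intro cond_indep_if_kernel_ignores[OF P[OF XZ] XYZ(2,1,3)])
qed

text \<open>Faithfulness is applied with \<open>I = X \<union> Z\<close>, which may overlap the sets
  being separated.\<close>

lemma affects_if_not_d_sep:
  assumes "causal_model M" "faithful M"
    and "X \<subseteq> observed M" "Y \<subseteq> observed M" "Z \<subseteq> observed M" "disjoint3 X Y Z"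
    and "\<not> d_sep (do_graph (graph M) (X \<union> Z)) Y X Z"
  shows "affects M X Y Z"
proof (rule ccontr)
  assume "\<not> affects M X Y Z"
  then have "cond_indep (val M) (dist M (X \<union> Z)) Y X Z"
    using assms by (intro cond_indep_if_not_affects)
  moreover have "disjoint3 Y X Z" "X \<union> Z \<subseteq> observed M"
    using assms by (auto simp: disjoint3_def)
  ultimately show False
    using assms unfolding faithful_def by blast
qed

text \<open>This is the contrapositive of the third rule with its \<open>X\<close> and
  \<open>Z\<close> exchanged: here \<open>Z\<close> is the set whose intervention is kept.\<close>

lemma not_d_sep_if_affects:
  assumes "do_rule3 M"
    and "X \<subseteq> observed M" "Y \<subseteq> observed M" "Z \<subseteq> observed M" "disjoint3 X Y Z"
    and "affects M X Y Z"
  shows "\<not> d_sep (do_graph (graph M) (X \<union> Z)) Y X Z"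
proof
  assume "d_sep (do_graph (graph M) (X \<union> Z)) Y X Z"
  then have "d_sep (do_graph (graph M) (Z \<union> X)) Y X Z"
    by (simp add: Un_commute)
  moreover have "disjoint3 Z Y X"
    using assms by (auto simp: disjoint3_def)
  ultimately have "\<forall>w\<in>space (PiM (Z \<union> X) (val M)).
      do_dist M (Z \<union> X) Y w = do_dist M Z Y (restrict w Z)"
    using assms unfolding do_rule3_def by blast
  then show False
    using \<open>affects M X Y Z\<close> by (auto simp: affects_def Un_commute)
qed

theorem theorem4p12:
  fixes M :: "('v, 'a) causal_data" and X Y Z :: "'v set"
  assumes "causal_model M"
    and "do_rule3 M"
    and "X \<subseteq> observed M" and "Y \<subseteq> observed M" and "Z \<subseteq> observed M"
    and "disjoint3 X Y Z" and "X \<noteq> {}" and "Y \<noteq> {}"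
    and "affects M X Y Z"
    and "clus1 M X Y Z \<or> clus2 M X Y Z \<or> clus3 M X Y Z"
  shows "fine_tuned M"
  unfolding fine_tuned_def
proof
  assume "faithful M"
  obtain x y where xy: "x \<in> X" "y \<in> Y"
    and shrink: "\<And>X' Y' Z'. \<lbrakk>x \<in> X'; y \<in> Y'; X' \<subseteq> X; Z' \<subseteq> Z\<rbrakk> \<Longrightarrow>
      \<not> d_sep (do_graph (graph M) (X' \<union> Z')) Y' X' Z'"
    using not_d_sep_do_graph_shrink[OF not_d_sep_if_affects] assms by metis
  \<comment> \<open>Under faithfulness the affects relation survives every shrinking that keeps
    \<open>x\<close> and \<open>y\<close>, contrary to each kind of clustering.\<close>
  have affects: "affects M X' Y' Z'"
    if "x \<in> X'" "y \<in> Y'" "X' \<subseteq> X" "Y' \<subseteq> Y" "Z' \<subseteq> Z" for X' Y' Z'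
  proof (rule affects_if_not_d_sep[OF \<open>causal_model M\<close> \<open>faithful M\<close>])
    show "\<not> d_sep (do_graph (graph M) (X' \<union> Z')) Y' X' Z'"
      using that by (intro shrink)
    show "disjoint3 X' Y' Z'"
      using that \<open>disjoint3 X Y Z\<close> unfolding disjoint3_def by blast
  qed (use that assms in auto)
  consider "clus1 M X Y Z" | "clus2 M X Y Z" | "clus3 M X Y Z"
    using assms by blast
  then show False
  proof cases
    case 1
    \<comment> \<open>The bound \<open>card X \<ge> 2\<close> makes the singleton a proper
      subset.\<close>
    then have "{x} \<subset> X"
      using xy by (auto simp: clus1_def)
    then show False
      using 1 affects[of "{x}" Y Z] xy by (auto simp: clus1_def)
  next
    case 2
    then have "{y} \<subset> Y"
      using xy by (auto simp: clus2_def)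
    then show False
      using 2 affects[of X "{y}" Z] xy by (auto simp: clus2_def)
  next
    case 3
    \<comment> \<open>Since \<open>card Z \<ge> 1\<close>, the empty set is a proper subset, and
      \<open>clus3\<close> admits it as a candidate.\<close>
    then have "{} \<subset> Z"
      by (auto simp: clus3_def)
    then show False
      using 3 affects[of X Y "{}"] xy by (auto simp: clus3_def)
  qed
qed

end
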